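(* For every instance of the Bamboo Garden Trimming problem, i.e. for every $n\ge 1$ and all growth rates $h_1\ge\dots\ge h_n>0$ with $\sum_{i=1}^n h_i=1$, the strategy Reduce-Max (with ties broken arbitrarily) guarantees a makespan of $9$; that is, no bamboo ever reaches a height larger than $9$.
   Context: Bamboo Garden Trimming (BGT) problem: a garden contains $n$ bamboos $b_1,\dots,b_n$; bamboo $b_i$ has daily growth rate $h_i>0$, with $h_1\ge\dots\ge h_n$ and $\sum_{i=1}^n h_i=1$. Initially all heights are $0$. Days are numbered $1,2,3,\dots$. At the end of each day at most one bamboo is trimmed, which instantaneously resets its height to $0$. The height of $b_i$ at the end of day $d\ge1$, before the trimming decision of that day, is $(d-d')h_i$, where $d'<d$ is the last day preceding $d$ in which $b_i$ was trimmed ($d'=0$ if $b_i$ was never trimmed before day $d$). A perpetual schedule specifies which bamboo (if any) is trimmed at the end of each day. The makespan of a schedule is the maximum height (measured at the end of a day, before trimming) ever reached by any bamboo over all days. Reduce-Max: at the end of every day, trim a tallest bamboo (ties are broken arbitrarily). *)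

theory Defs
  imports Complex_Main "HOL-Library.Extended_Real"
begin

text \<open>Bamboos are indexed by \<open>{1..n}\<close>; \<open>h i\<close> is the daily growth rate of bamboo \<open>i\<close>,
  and only the values of \<open>h\<close> on \<open>{1..n}\<close> matter.\<close>

definition bgt_instance :: "nat \<Rightarrow> (nat \<Rightarrow> real) \<Rightarrow> bool" where
  "bgt_instance n h \<longleftrightarrow>
     n \<ge> 1 \<and> (\<forall>i\<in>{1..n}. h i > 0) \<and>
     (\<forall>i\<in>{1..n}. \<forall>j\<in>{1..n}. i \<le> j \<longrightarrow> h j \<le> h i) \<and>
     (\<Sum>i=1..n. h i) = 1"

text \<open>\<open>s d\<close> is the bamboo trimmed at the end of day \<open>d\<close>, or \<open>None\<close> if none is trimmed.
  Days start at 1; the value \<open>s 0\<close> is never consulted.\<close>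

type_synonym schedule = "nat \<Rightarrow> nat option"

text \<open>The last day before \<open>d\<close> on which \<open>i\<close> was trimmed, 0 if there is none.\<close>

definition last_trim :: "schedule \<Rightarrow> nat \<Rightarrow> nat \<Rightarrow> nat" where
  "last_trim s d i = Max (insert 0 {d'. 1 \<le> d' \<and> d' < d \<and> s d' = Some i})"

text \<open>The height at the end of day \<open>d\<close>, before the trimming of that day.\<close>

definition height :: "(nat \<Rightarrow> real) \<Rightarrow> schedule \<Rightarrow> nat \<Rightarrow> nat \<Rightarrow> real" where
  "height h s d i = (real d - real (last_trim s d i)) * h i"

text \<open>For an arbitrary schedule the heights may be unbounded or the maximum unattained,
  so the makespan is a supremum in the extended reals.\<close>

definition makespan :: "nat \<Rightarrow> (nat \<Rightarrow> real) \<Rightarrow> schedule \<Rightarrow> ereal" where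
  "makespan n h s = (SUP d\<in>{1..}. SUP i\<in>{1..n}. ereal (height h s d i))"

text \<open>Ties are broken arbitrarily: this is a predicate satisfied by every schedule that
  trims some tallest bamboo at the end of each day.\<close>

definition reduce_max :: "nat \<Rightarrow> (nat \<Rightarrow> real) \<Rightarrow> schedule \<Rightarrow> bool" where
  "reduce_max n h s \<longleftrightarrow>
     (\<forall>d\<ge>1. \<exists>i\<in>{1..n}. s d = Some i \<and> (\<forall>j\<in>{1..n}. height h s d j \<le> height h s d i))"

lemma makespan_le_iff:
  "makespan n h s \<le> ereal c \<longleftrightarrow> (\<forall>d\<ge>1. \<forall>i\<in>{1..n}. height h s d i \<le> c)"
  by (auto simp: makespan_def SUP_le_iff)

end

theory Submission
  imports Defs
begin

text \<open>
  Suppose that on day \<open>D\<close> the tallest bamboo has height \<open>M \<ge> 3\<close>, and let \<open>P < D\<close> be the last day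
  whose tallest bamboo is below \<open>3\<close>. In any window \<open>(a, D]\<close> with \<open>a \<ge> P\<close> every trim removes at
  least \<open>3\<close>, so all but a third of the trims hit a bamboo for the first time in the window: at
  least \<open>2/3\<close> of the window length is the number of distinct bamboos trimmed there.
  Let \<open>e\<^sub>k\<close> be the latest day such that \<open>2\<^sup>k\<close> distinct bamboos are trimmed in \<open>[e\<^sub>k, D]\<close> (or \<open>P\<close> if there
  is none), and \<open>y\<^sub>k\<close> the least trimmed height in \<open>[e\<^sub>k, D]\<close>. All bamboos have height at most
  \<open>y\<^bsub>k+1\<^esub>\<close> at some day since \<open>e\<^bsub>k+1\<^esub>\<close>, while each bamboo trimmed in \<open>[e\<^sub>k, D]\<close> later reaches \<open>y\<^sub>k\<close>, so its
  rate is at least \<open>(y\<^sub>k - y\<^bsub>k+1\<^esub>) / (D - e\<^bsub>k+1\<^esub>)\<close>, where \<open>D - e\<^bsub>k+1\<^esub> \<le> 3/2 \<cdot> 2\<^bsup>k+1\<^esup>\<close>. Adding this up over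
  the at least \<open>2\<^sup>k / 2\<close> bamboos that are in \<open>[e\<^sub>k, D]\<close> but not in \<open>[e\<^bsub>k-1\<^esub>, D]\<close> gives total
  rate at least \<open>(y\<^sub>k - y\<^bsub>k+1\<^esub>) / 6\<close>; the sum over \<open>k\<close> telescopes to \<open>(M - 3) / 6 \<le> 1\<close>.
\<close>

section \<open>Heights from one day to the next\<close>

lemma last_trim_0: "last_trim s 0 i = 0"
  by (simp add: last_trim_def)

lemma last_trim_Suc:
  "last_trim s (Suc d) i = (if d \<ge> 1 \<and> s d = Some i then d else last_trim s d i)"
proof (cases "d \<ge> 1 \<and> s d = Some i")
  case True
  have "finite {d'. 1 \<le> d' \<and> d' < Suc d \<and> s d' = Some i}"
    by (rule finite_subset[of _ "{..d}"]) auto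
  with True show ?thesis
    unfolding last_trim_def by (auto intro!: Max_eqI)
next
  case False
  then have "{d'. 1 \<le> d' \<and> d' < Suc d \<and> s d' = Some i} = {d'. 1 \<le> d' \<and> d' < d \<and> s d' = Some i}"
    using less_Suc_eq by auto
  with False show ?thesis
    unfolding last_trim_def by auto
qed

lemma height_0: "height h s 0 i = 0"
  by (simp add: height_def last_trim_0)

lemma height_Suc:
  "height h s (Suc d) i = (if d \<ge> 1 \<and> s d = Some i then 0 else height h s d i) + h i"
  by (auto simp: height_def last_trim_Suc algebra_simps)

locale reduce_max_run =
  fixes n :: nat and h :: "nat \<Rightarrow> real" and s :: schedule
  assumes inst: "bgt_instance n h" and greedy: "reduce_max n h s"
begin

definition trimmed :: "nat \<Rightarrow> nat" where
  "trimmed d = the (s d)"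

text \<open>Day \<open>0\<close> gets the value \<open>0\<close>, so a day below \<open>3\<close>
  always exists.\<close>

definition tallest :: "nat \<Rightarrow> real" where
  "tallest d = (if d = 0 then 0 else height h s d (trimmed d))"

lemma rate_pos: "i \<in> {1..n} \<Longrightarrow> h i > 0"
  using inst by (auto simp: bgt_instance_def)

lemma rate_sum_le_1:
  assumes "A \<subseteq> {1..n}"
  shows "sum h A \<le> 1"
proof -
  have "sum h A \<le> sum h {1..n}"
    using assms rate_pos by (intro sum_mono2) (auto intro: less_imp_le)
  then show ?thesis
    using inst by (simp add: bgt_instance_def)
qed

lemma schedule_eq: "d \<ge> 1 \<Longrightarrow> s d = Some (trimmed d)"
  and trimmed_in: "d \<ge> 1 \<Longrightarrow> trimmed d \<in> {1..n}"
  using greedy by (fastforce simp: reduce_max_def trimmed_def)+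

lemma height_le_tallest: "i \<in> {1..n} \<Longrightarrow> height h s d i \<le> tallest d"
proof (cases "d = 0")
  case False
  with greedy have "\<exists>k. s d = Some k \<and> (\<forall>j\<in>{1..n}. height h s d j \<le> height h s d k)"
    unfolding reduce_max_def by (metis One_nat_def Suc_leI neq0_conv)
  with False show "height h s d i \<le> tallest d" if "i \<in> {1..n}"
    using that by (auto simp: tallest_def trimmed_def)
qed (simp add: tallest_def height_0)

lemma height_Suc_trimmed:
  "height h s (Suc d) i = (if d \<ge> 1 \<and> trimmed d = i then 0 else height h s d i) + h i"
  using schedule_eq[of d] by (auto simp: height_Suc)

lemma height_nonneg: "i \<in> {1..n} \<Longrightarrow> height h s d i \<ge> 0"
  using rate_pos[of i] by (induction d) (auto simp: height_0 height_Suc)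

lemma height_growth:
  assumes "i \<in> {1..n}" "e \<le> d"
  shows "height h s d i \<le> height h s e i + h i * real (d - e)"
  using assms(2)
proof (induction d rule: dec_induct)
  case (step d)
  have "height h s (Suc d) i \<le> height h s d i + h i"
    using height_nonneg[OF assms(1)] by (auto simp: height_Suc)
  also have "\<dots> \<le> height h s e i + h i * real (Suc d - e)"
    using step by (simp add: Suc_diff_le algebra_simps)
  finally show ?case .
qed simp

section \<open>Repeated trims in a window of days\<close>

text \<open>Between two trims in the window \<open>i\<close> regrows from \<open>0\<close> to at
  least \<open>x\<close>. The first trim may remove height grown before the window, hence the
  \<open>- 1\<close>.\<close>

lemma trim_count_le:
  assumes i: "i \<in> {1..n}" and "a \<le> b"
    and tall: "\<And>d. d \<in> {a<..b} \<Longrightarrow> x \<le> tallest d"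
    and "i \<in> trimmed ` {a<..b}"
  shows "x * (real (card {d \<in> {a<..b}. trimmed d = i}) - 1) \<le> h i * real (b - a)"
proof -
  define N where "N b = card {d \<in> {a<..b}. trimmed d = i}" for b
  have N_Suc: "N (Suc t) = (if trimmed (Suc t) = i then Suc (N t) else N t)" if "a \<le> t" for t
  proof (cases "trimmed (Suc t) = i")
    case True
    with that have "{d \<in> {a<..Suc t}. trimmed d = i} = insert (Suc t) {d \<in> {a<..t}. trimmed d = i}"
      by auto
    with True show ?thesis by (simp add: N_def)
  next
    case False
    with that have "{d \<in> {a<..Suc t}. trimmed d = i} = {d \<in> {a<..t}. trimmed d = i}"
      by (auto simp: le_Suc_eq)
    with False show ?thesis by (simp add: N_def)
  qed
  \<comment> \<open>The extra \<open>x\<close> on the right pays for the first trim. Until then the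
    height brought into the window is not controlled, hence the guard.\<close>
  have "N b > 0 \<longrightarrow> x * real (N b) + height h s (Suc b) i \<le> x + h i * real (Suc b - a)"
    using \<open>a \<le> b\<close> tall
  proof (induction b rule: dec_induct)
    case base
    then show ?case by (simp add: N_def)
  next
    case (step t)
    have IH: "N t > 0 \<longrightarrow> x * real (N t) + height h s (Suc t) i \<le> x + h i * real (Suc t - a)"
      by (rule step.IH) (use step.prems in auto)
    have len: "real (Suc (Suc t) - a) = real (Suc t - a) + 1"
      using step.hyps by linarith
    have rate: "h i * real (Suc t - a) \<ge> 0"
      using rate_pos[OF i] by simp
    show ?case
    proof (cases "trimmed (Suc t) = i")
      case True
      then have "x \<le> height h s (Suc t) i"
        using step.prems[of "Suc t"] step.hyps by (simp add: tallest_def)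
      then show ?thesis
        using IH True rate N_Suc[OF step.hyps(1)]
        by (cases "N t = 0") (auto simp: height_Suc_trimmed[of "Suc t"] len algebra_simps)
    next
      case False
      then show ?thesis
        using IH N_Suc[OF step.hyps(1)]
        by (auto simp: height_Suc_trimmed[of "Suc t"] len algebra_simps)
    qed
  qed
  moreover have "N b > 0"
    using assms(4) by (auto simp: N_def card_gt_0_iff)
  moreover have "h i \<le> height h s (Suc b) i"
    using height_nonneg[OF i] by (auto simp: height_Suc)
  moreover have "real (Suc b - a) = real (b - a) + 1"
    using \<open>a \<le> b\<close> by linarith
  ultimately show ?thesis
    by (simp add: N_def algebra_simps)
qed

text \<open>Sums \<open>trim_count_le\<close> over the trimmed bamboos, whose rates add up to at
  most \<open>1\<close>.\<close>

lemma window_length_le: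
  assumes "a \<le> b" and tall: "\<And>d. d \<in> {a<..b} \<Longrightarrow> x \<le> tallest d"
  shows "x * (real (b - a) - real (card (trimmed ` {a<..b}))) \<le> real (b - a)"
proof -
  let ?T = "trimmed ` {a<..b}"
  let ?N = "\<lambda>i. card {d \<in> {a<..b}. trimmed d = i}"
  have T: "?T \<subseteq> {1..n}"
    using trimmed_in by fastforce
  have "(\<Sum>i\<in>?T. ?N i) = (\<Sum>d\<in>{a<..b}. 1)"
    using sum.image_gen[of "{a<..b}" "\<lambda>_. 1::nat" trimmed] by simp
  then have "(\<Sum>i\<in>?T. real (?N i)) = real (b - a)"
    by (simp flip: of_nat_sum)
  then have "x * (real (b - a) - real (card ?T)) = (\<Sum>i\<in>?T. x * (real (?N i) - 1))"
    by (simp add: sum_subtractf flip: sum_distrib_left)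
  also have "\<dots> \<le> (\<Sum>i\<in>?T. h i * real (b - a))"
    using T assms by (intro sum_mono trim_count_le) auto
  also have "\<dots> = sum h ?T * real (b - a)"
    by (simp add: sum_distrib_right)
  also have "\<dots> \<le> 1 * real (b - a)"
    by (intro mult_right_mono rate_sum_le_1 T) simp
  finally show ?thesis by simp
qed

section \<open>Rates forced by the descent of trimmed heights\<close>

text \<open>At \<open>d = e\<^sub>k\<close> this is the \<open>y\<^sub>k\<close> of the
  introduction.\<close>

definition low :: "nat \<Rightarrow> nat \<Rightarrow> real" where
  "low D d = Min (tallest ` {d..D})"

lemma low_le: "d \<le> e \<Longrightarrow> e \<le> D \<Longrightarrow> low D d \<le> tallest e"
  by (simp add: low_def)

lemma low_attained:
  assumes "d \<le> D"
  obtains e where "d \<le> e" "e \<le> D" "tallest e = low D d"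
proof -
  have "low D d \<in> tallest ` {d..D}"
    unfolding low_def using assms by (intro Min_in) auto
  then show ?thesis using that by auto
qed

text \<open>If \<open>low D a\<close> is attained before \<open>d\<close>, then \<open>i\<close>
  must still grow to at least \<open>low D d\<close> by its trim; otherwise the left side is at most
  \<open>0\<close>.\<close>

lemma rate_ge:
  assumes "a \<le> d" "d \<le> D" "d \<ge> 1" and i: "i \<in> trimmed ` {d..D}"
  shows "low D d - low D a \<le> h i * real (D - a)"
proof -
  from i obtain f where f: "d \<le> f" "f \<le> D" "trimmed f = i" by auto
  have i': "i \<in> {1..n}" using trimmed_in[of f] f assms by simp
  obtain e where e: "a \<le> e" "e \<le> D" "tallest e = low D a"
    using low_attained[of a D] assms by auto
  show ?thesis
  proof (cases "e < d")
    case True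
    have "low D d \<le> height h s f i"
      using low_le[of d f D] f assms by (simp add: tallest_def)
    also have "\<dots> \<le> height h s e i + h i * real (f - e)"
      using True f by (intro height_growth i') auto
    also have "height h s e i \<le> low D a"
      using height_le_tallest[OF i', of e] e by simp
    also have "h i * real (f - e) \<le> h i * real (D - a)"
      using rate_pos[OF i'] f e True by (intro mult_left_mono) auto
    finally show ?thesis by simp
  next
    case False
    then have "low D d \<le> low D a"
      using low_le[of d e D] e by simp
    then show ?thesis
      using rate_pos[OF i'] by (simp add: order_trans[of _ 0])
  qed
qed

text \<open>
  Here \<open>d\<close> is the day \<open>e\<^sub>k\<close> of the introduction. The set \<open>B\<close> has paid for the descent from \<open>D\<close>
  to \<open>d\<close>; as it has at most \<open>2\<^sup>k / 2\<close> elements, half of the bamboos trimmed in \<open>[d, D]\<close> are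
  still available to pay for the next step.
\<close>

lemma dyadic_descent:
  assumes "P < D" and tall: "\<And>d. d \<in> {P<..D} \<Longrightarrow> 3 \<le> tallest d"
  shows "\<exists>d B. P \<le> d \<and> d \<le> D \<and> card (trimmed ` {d<..D}) < 2 ^ k \<and>
           (d = P \<or> card (trimmed ` {d..D}) \<ge> 2 ^ k) \<and>
           B \<subseteq> trimmed ` {d..D} \<inter> {1..n} \<and> 2 * card B \<le> 2 ^ k \<and> low D D - low D d \<le> 6 * sum h B"
proof (induction k)
  case 0
  show ?case
    by (rule exI[of _ D], rule exI[of _ "{}"]) (use \<open>P < D\<close> in simp)
next
  case (Suc k)
  then obtain d B where d: "P \<le> d" "d \<le> D" and less: "card (trimmed ` {d<..D}) < 2 ^ k"
    and ge: "d = P \<or> card (trimmed ` {d..D}) \<ge> 2 ^ k"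
    and B: "B \<subseteq> trimmed ` {d..D} \<inter> {1..n}" "2 * card B \<le> 2 ^ k"
    and le: "low D D - low D d \<le> 6 * sum h B"
    by blast
  show ?case
  proof (cases "d = P")
    case True
    show ?thesis
      by (rule exI[of _ d], rule exI[of _ B]) (use True d less B le in simp)
  next
    case False
    let ?T = "trimmed ` {d..D}"
    have T_sub: "?T \<subseteq> {1..n}"
      using trimmed_in d False by fastforce
    have fin_B: "finite B" using B by (auto intro: finite_subset)
    \<comment> \<open>One more day adds at most one bamboo, so the count is exactly
      \<open>2 ^ k\<close>.\<close>
    have "{d..D} = insert d {d<..D}" using d by auto
    then have "card ?T \<le> Suc (card (trimmed ` {d<..D}))"
      by (simp add: card_insert_if)
    with less ge False have card_T: "card ?T = 2 ^ k" by simp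
    define X where "X = {e. P \<le> e \<and> e < d \<and> (e = P \<or> card (trimmed ` {e..D}) \<ge> 2 ^ Suc k)}"
    define e where "e = Max X"
    have fin: "finite X" unfolding X_def by simp
    have "P \<in> X" using d False by (simp add: X_def)
    then have e_in: "e \<in> X" unfolding e_def using fin by (intro Max_in) auto
    have e: "P \<le> e" "e < d" using e_in by (auto simp: X_def)
    have "{e<..D} = {Suc e..D}" by auto
    have card_e: "card (trimmed ` {e<..D}) < 2 ^ Suc k"
    proof (cases "Suc e = d")
      case True
      then show ?thesis using card_T \<open>{e<..D} = {Suc e..D}\<close> by simp
    next
      case False
      have "Suc e \<notin> X" using Max_ge[OF fin, of "Suc e"] by (auto simp flip: e_def)
      with False e \<open>{e<..D} = {Suc e..D}\<close> show ?thesis by (auto simp: X_def)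
    qed
    have "3 * (real (D - e) - real (card (trimmed ` {e<..D}))) \<le> real (D - e)"
      using e d by (intro window_length_le tall) auto
    moreover have "real (card (trimmed ` {e<..D})) \<le> 2 ^ Suc k"
      using card_e by (metis less_imp_le of_nat_le_numeral_power_cancel_iff)
    ultimately have len: "real (D - e) \<le> 3 * 2 ^ k" by simp
    define \<Delta> where "\<Delta> = low D d - low D e"
    have rate: "\<Delta> / (3 * 2 ^ k) \<le> h i" if "i \<in> ?T - B" for i
    proof -
      have i: "i \<in> {1..n}" using that T_sub by auto
      have "\<Delta> \<le> h i * real (D - e)"
        unfolding \<Delta>_def using that e d by (intro rate_ge) auto
      also have "\<dots> \<le> h i * (3 * 2 ^ k)"
        using rate_pos[OF i] len by (intro mult_left_mono) auto
      finally show ?thesis by (simp add: field_simps)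
    qed
    have "\<Delta> \<ge> 0"
    proof -
      obtain f where "d \<le> f" "f \<le> D" "tallest f = low D d"
        using low_attained d by blast
      then show ?thesis using low_le[of e f D] e by (simp add: \<Delta>_def)
    qed
    have "card (?T - B) = 2 ^ k - card B"
      using B card_T fin_B by (simp add: card_Diff_subset)
    with B(2) have "2 ^ k \<le> 2 * card (?T - B)" by simp
    then have card_new: "2 ^ k \<le> 2 * real (card (?T - B))"
      using of_nat_le_iff[of "2 ^ k" "2 * card (?T - B)", where 'a = real] by simp
    \<comment> \<open>The constant \<open>6\<close>: at least \<open>2 ^ k / 2\<close> new bamboos
      have rate at least \<open>\<Delta> / (3 * 2 ^ k)\<close>.\<close>
    have "\<Delta> = 6 * (2 ^ k / 2 * (\<Delta> / (3 * 2 ^ k)))" by simp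
    also have "\<dots> \<le> 6 * (real (card (?T - B)) * (\<Delta> / (3 * 2 ^ k)))"
      using card_new \<open>\<Delta> \<ge> 0\<close> by (intro mult_left_mono mult_right_mono) auto
    also have "\<dots> \<le> 6 * sum h (?T - B)"
      using sum_bounded_below[of "?T - B" "\<Delta> / (3 * 2 ^ k)" h, OF rate]
      by (intro mult_left_mono) auto
    finally have "low D D - low D e \<le> 6 * (sum h B + sum h (?T - B))"
      using le by (simp add: \<Delta>_def)
    also have "sum h B + sum h (?T - B) = sum h ?T"
      using B by (subst sum.subset_diff[of B ?T h]) auto
    finally have "low D D - low D e \<le> 6 * sum h ?T" .
    moreover have "?T \<subseteq> trimmed ` {e..D} \<inter> {1..n}" using T_sub e by auto
    \<comment> \<open>All of \<open>?T\<close> becomes the new \<open>B\<close>: its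
      \<open>2 ^ k\<close> elements are half of \<open>2 ^ Suc k\<close>.\<close>
    ultimately show ?thesis
      using e d e_in card_e card_T
      by (intro exI[of _ e] exI[of _ ?T]) (auto simp: X_def)
  qed
qed

lemma tallest_le_9: "tallest D \<le> 9"
proof (cases "tallest D < 3")
  case False
  define X where "X = {d. d < D \<and> tallest d < 3}"
  define P where "P = Max X"
  have fin: "finite X" unfolding X_def by simp
  have "0 \<in> X" using False by (cases "D = 0") (auto simp: X_def tallest_def)
  then have "P \<in> X" unfolding P_def using fin by (intro Max_in) auto
  then have P: "P < D" "tallest P < 3" by (auto simp: X_def)
  have tall: "3 \<le> tallest d" if "d \<in> {P<..D}" for d
  proof (cases "d = D")
    case True
    then show ?thesis using False by simp
  next
    case neq: False
    have "d \<notin> X" using Max_ge[OF fin, of d] that by (auto simp flip: P_def)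
    with neq that show ?thesis by (auto simp: X_def)
  qed
  \<comment> \<open>With \<open>k = n\<close>, the count \<open>2 ^ n\<close> exceeds the number of
    bamboos, which forces \<open>d = P\<close>.\<close>
  obtain d B where d: "P \<le> d" "d \<le> D" "d = P \<or> card (trimmed ` {d..D}) \<ge> 2 ^ n"
    and B: "B \<subseteq> {1..n}" "low D D - low D d \<le> 6 * sum h B"
    using dyadic_descent[OF P(1) tall, of n] by blast
  have "d = P"
  proof (rule ccontr)
    assume "d \<noteq> P"
    then have "trimmed ` {d..D} \<subseteq> {1..n}" using trimmed_in d by fastforce
    then have "card (trimmed ` {d..D}) \<le> n"
      using card_mono[of "{1..n}"] by fastforce
    then show False using d \<open>d \<noteq> P\<close> less_exp[of n] by linarith
  qed
  moreover have "low D D = tallest D" by (simp add: low_def)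
  \<comment> \<open>\<open>9 = 3 + 6 * 1\<close>: below \<open>3\<close> on day \<open>P\<close>,
    and total rate at most \<open>1\<close>.\<close>
  ultimately show ?thesis
    using B(2) rate_sum_le_1[OF B(1)] low_le[of P P D] P by simp
qed simp

end

theorem theorem1:
  fixes n :: nat and h :: "nat \<Rightarrow> real" and s :: schedule
  assumes "bgt_instance n h"
    and "reduce_max n h s"
  shows "makespan n h s \<le> 9"
proof -
  interpret reduce_max_run n h s
    by unfold_locales (use assms in auto)
  have "makespan n h s \<le> ereal 9"
    unfolding makespan_le_iff using height_le_tallest tallest_le_9 order_trans by blast
  then show ?thesis by simp
qed

end
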